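(* For every $\alpha\leq\omega$, the relation $\mathcal{L}^{\alpha}$ on closed $\mu$TCL terms is a congruence on the term algebra $\mathrm{Tr}$; that is, for every operation symbol $\mathsf{f}\colon \tau_1\times\cdots\times\tau_k\to\tau$ of the signature and all closed terms $t_i,s_i$ of type $\tau_i$ with $\mathcal{L}^\alpha_{\tau_i}(t_i,s_i)$ for $i=1,\dots,k$, one has $\mathcal{L}^\alpha_\tau(\mathsf{f}(t_1,\dots,t_k),\mathsf{f}(s_1,\dots,s_k))$.
   Context: Types of $\mu$TCL: closed type expressions, modulo $\alpha$-equivalence, of the grammar $\tau::=\alpha\mid \tau_1\boxplus\tau_2\mid\tau_1\boxtimes\tau_2\mid \tau_1\Rightarrow\tau_2\mid \mu\alpha.\tau$ ($\alpha$ ranging over type variables); $\tau[\sigma/\alpha]$ is capture-avoiding substitution. $\mathrm{Tr}$ is the type-indexed set of closed terms over the following many-sorted signature (type indices range over all closed types, $\tau$ in fold/unfold over types with at most $\alpha$ free): constants $S_{\tau_1,\tau_2,\tau_3}\colon(\tau_1\Rightarrow\tau_2\Rightarrow\tau_3)\Rightarrow(\tau_1\Rightarrow\tau_2)\Rightarrow\tau_1\Rightarrow\tau_3$, $K_{\tau_1,\tau_2}\colon \tau_1\Rightarrow\tau_2\Rightarrow\tau_1$, $I_\tau\colon\tau\Rightarrow\tau$; operations $S'\colon(\tau_1\Rightarrow\tau_2\Rightarrow\tau_3)\to((\tau_1\Rightarrow\tau_2)\Rightarrow\tau_1\Rightarrow\tau_3)$, $S''\colon (\tau_1\Rightarrow\tau_2\Rightarrow\tau_3)\times(\tau_1\Rightarrow\tau_2)\to(\tau_1\Rightarrow\tau_3)$,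 $K'\colon\tau_1\to(\tau_2\Rightarrow\tau_1)$, application $\mathsf{app}\colon(\tau_1\Rightarrow\tau_2)\times\tau_1\to\tau_2$ (written $t\,s$), $\mathsf{inl}\colon\tau_1\to\tau_1\boxplus\tau_2$, $\mathsf{inr}\colon\tau_2\to\tau_1\boxplus\tau_2$, $\mathsf{case}\colon(\tau_1\boxplus\tau_2)\times(\tau_1\Rightarrow\tau_3)\times(\tau_2\Rightarrow\tau_3)\to\tau_3$, $\mathsf{pair}\colon\tau_1\times\tau_2\to\tau_1\boxtimes\tau_2$, $\mathsf{fst}\colon\tau_1\boxtimes\tau_2\to\tau_1$, $\mathsf{snd}\colon\tau_1\boxtimes\tau_2\to\tau_2$, $\mathsf{fold}_\tau\colon\tau[\mu\alpha.\tau/\alpha]\to\mu\alpha.\tau$, $\mathsf{unfold}_\tau\colon\mu\alpha.\tau\to\tau[\mu\alpha.\tau/\alpha]$. Transitions on closed terms are exactly those derivable by the rules (for all appropriately typed closed $e,t,t',s,r$): $S\xrightarrow{e}S'(e)$; $S'(t)\xrightarrow{e}S''(t,e)$; $S''(t,s)\xrightarrow{e}(t\,e)(s\,e)$; $K\xrightarrow{e}K'(e)$; $K'(t)\xrightarrow{e}t$; $I\xrightarrow{e}e$; if $t\to t'$ then $t\,s\to t'\,s$; if $t\xrightarrow{s}t'$ then $t\,s\to t'$; $\mathsf{inl}(t)\xrightarrow{\boxplus_1}t$; $\mathsf{inr}(t)\xrightarrow{\boxplus_2}t$; if $t\to t'$ then $\mathsf{case}(t,s,r)\to\mathsf{case}(t',s,r)$;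 if $t\xrightarrow{\boxplus_1}t'$ then $\mathsf{case}(t,s,r)\to s\,t'$; if $t\xrightarrow{\boxplus_2}t'$ then $\mathsf{case}(t,s,r)\to r\,t'$; $\mathsf{pair}(t,s)\xrightarrow{\boxtimes_1}t$; $\mathsf{pair}(t,s)\xrightarrow{\boxtimes_2}s$; if $t\to t'$ then $\mathsf{fst}(t)\to\mathsf{fst}(t')$ and $\mathsf{snd}(t)\to\mathsf{snd}(t')$; if $t\xrightarrow{\boxtimes_1}t'$ then $\mathsf{fst}(t)\to t'$; if $t\xrightarrow{\boxtimes_2}t'$ then $\mathsf{snd}(t)\to t'$; $\mathsf{fold}(t)\xrightarrow{\mu}t$; if $t\to t'$ then $\mathsf{unfold}(t)\to\mathsf{unfold}(t')$; if $t\xrightarrow{\mu}t'$ then $\mathsf{unfold}(t)\to t'$. Weak transitions: $\Rightarrow$ is the reflexive transitive closure of $\to$; $t\overset{l}{\Rightarrow}s$ iff $t\Rightarrow t'\xrightarrow{l}s$ for some $t'$. Relations on $\mathrm{Tr}$ are type-indexed families $R=(R_\tau\subseteq\mathrm{Tr}_\tau\times\mathrm{Tr}_\tau)$. Define $\mathcal{E}(R)_\tau=\{(t,s)\mid t\to t'\implies\exists s'.\,s\Rightarrow s'\wedge R_\tau(t',s')\}$ and $\mathcal{V}(Q,R)$ by: $\mathcal{V}_{\tau_1\boxplus\tau_2}(Q,R)=\{(t,s)\mid$ for $i=1,2$: $t\xrightarrow{\boxplus_i}t'\implies\exists s'.\,s\overset{\boxplus_i}{\Rightarrow}s'\wedge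 R_{\tau_i}(t',s')\}$; $\mathcal{V}_{\tau_1\boxtimes\tau_2}(Q,R)=\{(t,s)\mid t\xrightarrow{\boxtimes_1}t_1\wedge t\xrightarrow{\boxtimes_2}t_2\implies \exists s_1,s_2.\,s\overset{\boxtimes_1}{\Rightarrow}s_1\wedge s\overset{\boxtimes_2}{\Rightarrow}s_2\wedge R_{\tau_1}(t_1,s_1)\wedge R_{\tau_2}(t_2,s_2)\}$; $\mathcal{V}_{\tau_1\Rightarrow\tau_2}(Q,R)=\{(t,s)\mid$ for all $e_1,e_2$ with $Q_{\tau_1}(e_1,e_2)$: $t\xrightarrow{e_1}t'\implies\exists s'.\,s\overset{e_2}{\Rightarrow}s'\wedge R_{\tau_2}(t',s')\}$; $\mathcal{V}_{\mu\alpha.\tau}(Q,R)=\{(t,s)\mid t\xrightarrow{\mu}t'\implies\exists s'.\,s\overset{\mu}{\Rightarrow}s'\wedge R_{\tau[\mu\alpha.\tau/\alpha]}(t',s')\}$. The step-indexed logical relation: $\mathcal{L}^0=$ full relation, $\mathcal{L}^{n+1}=\mathcal{L}^n\cap\mathcal{E}(\mathcal{L}^n)\cap\mathcal{V}(\mathcal{L}^n,\mathcal{L}^n)$, $\mathcal{L}^\omega=\bigcap_{n<\omega}\mathcal{L}^n$. *)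

theory Defs
  imports Main "HOL-Library.Extended_Nat"
begin

section \<open>Types\<close>

text \<open>
  Type expressions modulo alpha-equivalence, in de Bruijn notation: \<^term>\<open>Mu\<close> binds index 0
  of its body.
\<close>

datatype ty =
    TVar nat
  | Sum ty ty  (infixr "\<boxplus>" 65)
  | Prod ty ty (infixr "\<boxtimes>" 70)
  | Arr ty ty  (infixr "\<rightarrow>" 60)
  | Mu ty

primrec ty_lift :: "nat \<Rightarrow> ty \<Rightarrow> ty" where
  "ty_lift k (TVar i) = TVar (if i < k then i else Suc i)"
| "ty_lift k (\<tau>\<^sub>1 \<boxplus> \<tau>\<^sub>2) = ty_lift k \<tau>\<^sub>1 \<boxplus> ty_lift k \<tau>\<^sub>2"
| "ty_lift k (\<tau>\<^sub>1 \<boxtimes> \<tau>\<^sub>2) = ty_lift k \<tau>\<^sub>1 \<boxtimes> ty_lift k \<tau>\<^sub>2"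
| "ty_lift k (\<tau>\<^sub>1 \<rightarrow> \<tau>\<^sub>2) = (ty_lift k \<tau>\<^sub>1 \<rightarrow> ty_lift k \<tau>\<^sub>2)"
| "ty_lift k (Mu \<tau>) = Mu (ty_lift (Suc k) \<tau>)"

text \<open>
  \<open>ty_subst k \<sigma> \<tau>\<close> replaces index \<open>k\<close> by \<open>\<sigma>\<close> and removes the binding level \<open>k\<close>, so larger indices
  are decremented.
\<close>

primrec ty_subst :: "nat \<Rightarrow> ty \<Rightarrow> ty \<Rightarrow> ty" where
  "ty_subst k \<sigma> (TVar i) = (if i < k then TVar i else if i = k then \<sigma> else TVar (i - 1))"
| "ty_subst k \<sigma> (\<tau>\<^sub>1 \<boxplus> \<tau>\<^sub>2) = ty_subst k \<sigma> \<tau>\<^sub>1 \<boxplus> ty_subst k \<sigma> \<tau>\<^sub>2"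
| "ty_subst k \<sigma> (\<tau>\<^sub>1 \<boxtimes> \<tau>\<^sub>2) = ty_subst k \<sigma> \<tau>\<^sub>1 \<boxtimes> ty_subst k \<sigma> \<tau>\<^sub>2"
| "ty_subst k \<sigma> (\<tau>\<^sub>1 \<rightarrow> \<tau>\<^sub>2) = (ty_subst k \<sigma> \<tau>\<^sub>1 \<rightarrow> ty_subst k \<sigma> \<tau>\<^sub>2)"
| "ty_subst k \<sigma> (Mu \<tau>) = Mu (ty_subst (Suc k) (ty_lift 0 \<sigma>) \<tau>)"

text \<open>All free indices of the type are below \<open>k\<close>.\<close>

primrec closed_at :: "nat \<Rightarrow> ty \<Rightarrow> bool" where
  "closed_at k (TVar i) \<longleftrightarrow> i < k"
| "closed_at k (\<tau>\<^sub>1 \<boxplus> \<tau>\<^sub>2) \<longleftrightarrow> closed_at k \<tau>\<^sub>1 \<and> closed_at k \<tau>\<^sub>2"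
| "closed_at k (\<tau>\<^sub>1 \<boxtimes> \<tau>\<^sub>2) \<longleftrightarrow> closed_at k \<tau>\<^sub>1 \<and> closed_at k \<tau>\<^sub>2"
| "closed_at k (\<tau>\<^sub>1 \<rightarrow> \<tau>\<^sub>2) \<longleftrightarrow> closed_at k \<tau>\<^sub>1 \<and> closed_at k \<tau>\<^sub>2"
| "closed_at k (Mu \<tau>) \<longleftrightarrow> closed_at (Suc k) \<tau>"

abbreviation closed_ty :: "ty \<Rightarrow> bool" where
  "closed_ty \<equiv> closed_at 0"

definition unroll :: "ty \<Rightarrow> ty" where
  "unroll \<tau> = ty_subst 0 (Mu \<tau>) \<tau>"


section \<open>Signature and terms\<close>

text \<open>\<open>FoldOp \<tau>\<close> and \<open>UnfoldOp \<tau>\<close> are indexed by the body of the recursive type \<open>Mu \<tau>\<close>.\<close>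

datatype opsym =
    S0Op ty ty ty | S1Op ty ty ty | S2Op ty ty ty
  | K0Op ty ty | K1Op ty ty | IOp ty
  | AppOp ty ty
  | InlOp ty ty | InrOp ty ty | CaseOp ty ty ty
  | PairOp ty ty | FstOp ty ty | SndOp ty ty
  | FoldOp ty | UnfoldOp ty

fun wf_op :: "opsym \<Rightarrow> bool" where
  "wf_op (S0Op a b c) \<longleftrightarrow> closed_ty a \<and> closed_ty b \<and> closed_ty c"
| "wf_op (S1Op a b c) \<longleftrightarrow> closed_ty a \<and> closed_ty b \<and> closed_ty c"
| "wf_op (S2Op a b c) \<longleftrightarrow> closed_ty a \<and> closed_ty b \<and> closed_ty c"
| "wf_op (K0Op a b) \<longleftrightarrow> closed_ty a \<and> closed_ty b"
| "wf_op (K1Op a b) \<longleftrightarrow> closed_ty a \<and> closed_ty b"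
| "wf_op (IOp a) \<longleftrightarrow> closed_ty a"
| "wf_op (AppOp a b) \<longleftrightarrow> closed_ty a \<and> closed_ty b"
| "wf_op (InlOp a b) \<longleftrightarrow> closed_ty a \<and> closed_ty b"
| "wf_op (InrOp a b) \<longleftrightarrow> closed_ty a \<and> closed_ty b"
| "wf_op (CaseOp a b c) \<longleftrightarrow> closed_ty a \<and> closed_ty b \<and> closed_ty c"
| "wf_op (PairOp a b) \<longleftrightarrow> closed_ty a \<and> closed_ty b"
| "wf_op (FstOp a b) \<longleftrightarrow> closed_ty a \<and> closed_ty b"
| "wf_op (SndOp a b) \<longleftrightarrow> closed_ty a \<and> closed_ty b"
| "wf_op (FoldOp \<tau>) \<longleftrightarrow> closed_at 1 \<tau>"
| "wf_op (UnfoldOp \<tau>) \<longleftrightarrow> closed_at 1 \<tau>"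

fun arg_tys :: "opsym \<Rightarrow> ty list" where
  "arg_tys (S0Op a b c) = []"
| "arg_tys (S1Op a b c) = [a \<rightarrow> b \<rightarrow> c]"
| "arg_tys (S2Op a b c) = [a \<rightarrow> b \<rightarrow> c, a \<rightarrow> b]"
| "arg_tys (K0Op a b) = []"
| "arg_tys (K1Op a b) = [a]"
| "arg_tys (IOp a) = []"
| "arg_tys (AppOp a b) = [a \<rightarrow> b, a]"
| "arg_tys (InlOp a b) = [a]"
| "arg_tys (InrOp a b) = [b]"
| "arg_tys (CaseOp a b c) = [a \<boxplus> b, a \<rightarrow> c, b \<rightarrow> c]"
| "arg_tys (PairOp a b) = [a, b]"
| "arg_tys (FstOp a b) = [a \<boxtimes> b]"
| "arg_tys (SndOp a b) = [a \<boxtimes> b]"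
| "arg_tys (FoldOp \<tau>) = [unroll \<tau>]"
| "arg_tys (UnfoldOp \<tau>) = [Mu \<tau>]"

fun res_ty :: "opsym \<Rightarrow> ty" where
  "res_ty (S0Op a b c) = ((a \<rightarrow> b \<rightarrow> c) \<rightarrow> (a \<rightarrow> b) \<rightarrow> a \<rightarrow> c)"
| "res_ty (S1Op a b c) = ((a \<rightarrow> b) \<rightarrow> a \<rightarrow> c)"
| "res_ty (S2Op a b c) = (a \<rightarrow> c)"
| "res_ty (K0Op a b) = (a \<rightarrow> b \<rightarrow> a)"
| "res_ty (K1Op a b) = (b \<rightarrow> a)"
| "res_ty (IOp a) = (a \<rightarrow> a)"
| "res_ty (AppOp a b) = b"
| "res_ty (InlOp a b) = a \<boxplus> b"
| "res_ty (InrOp a b) = a \<boxplus> b"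
| "res_ty (CaseOp a b c) = c"
| "res_ty (PairOp a b) = a \<boxtimes> b"
| "res_ty (FstOp a b) = a"
| "res_ty (SndOp a b) = b"
| "res_ty (FoldOp \<tau>) = Mu \<tau>"
| "res_ty (UnfoldOp \<tau>) = unroll \<tau>"

datatype tm = Op opsym "tm list"

inductive has_type :: "tm \<Rightarrow> ty \<Rightarrow> bool" (infix "\<turnstile>" 50) where
  "wf_op f \<Longrightarrow> list_all2 has_type ts (arg_tys f) \<Longrightarrow> has_type (Op f ts) (res_ty f)"

definition Tr :: "ty \<Rightarrow> tm set" where
  "Tr \<tau> = {t. t \<turnstile> \<tau>}"

abbreviation "S0 a b c \<equiv> Op (S0Op a b c) []"
abbreviation "S1 a b c t \<equiv> Op (S1Op a b c) [t]"
abbreviation "S2 a b c t s \<equiv> Op (S2Op a b c) [t, s]"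
abbreviation "K0 a b \<equiv> Op (K0Op a b) []"
abbreviation "K1 a b t \<equiv> Op (K1Op a b) [t]"
abbreviation "I0 a \<equiv> Op (IOp a) []"
abbreviation "App a b t s \<equiv> Op (AppOp a b) [t, s]"
abbreviation "TInl a b t \<equiv> Op (InlOp a b) [t]"
abbreviation "TInr a b t \<equiv> Op (InrOp a b) [t]"
abbreviation "Case a b c t s r \<equiv> Op (CaseOp a b c) [t, s, r]"
abbreviation "TPair a b t s \<equiv> Op (PairOp a b) [t, s]"
abbreviation "Fst a b t \<equiv> Op (FstOp a b) [t]"
abbreviation "Snd a b t \<equiv> Op (SndOp a b) [t]"
abbreviation "Fold \<tau> t \<equiv> Op (FoldOp \<tau>) [t]"
abbreviation "Unfold \<tau> t \<equiv> Op (UnfoldOp \<tau>) [t]"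


section \<open>Operational semantics\<close>

datatype label = Arg tm | Sum1 | Sum2 | Prod1 | Prod2 | MuL

text \<open>
  The labelled rules have no transitions among their premises, so labelled transitions come first
  and unlabelled steps are defined on top of them. The typing premises confine both relations to
  well-typed closed terms.
\<close>

inductive ltrans :: "tm \<Rightarrow> label \<Rightarrow> tm \<Rightarrow> bool" ("_ \<longmapsto>[_] _" [51, 0, 51] 50) where
  lt_S0: "S0 a b c \<turnstile> (a \<rightarrow> b \<rightarrow> c) \<rightarrow> (a \<rightarrow> b) \<rightarrow> a \<rightarrow> c \<Longrightarrow> e \<turnstile> a \<rightarrow> b \<rightarrow> c \<Longrightarrow>
    S0 a b c \<longmapsto>[Arg e] S1 a b c e"
| lt_S1: "S1 a b c t \<turnstile> (a \<rightarrow> b) \<rightarrow> a \<rightarrow> c \<Longrightarrow> e \<turnstile> a \<rightarrow> b \<Longrightarrow> S1 a b c t \<longmapsto>[Arg e] S2 a b c t e"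
| lt_S2: "S2 a b c t s \<turnstile> a \<rightarrow> c \<Longrightarrow> e \<turnstile> a \<Longrightarrow>
    S2 a b c t s \<longmapsto>[Arg e] App b c (App a (b \<rightarrow> c) t e) (App a b s e)"
| lt_K0: "K0 a b \<turnstile> a \<rightarrow> b \<rightarrow> a \<Longrightarrow> e \<turnstile> a \<Longrightarrow> K0 a b \<longmapsto>[Arg e] K1 a b e"
| lt_K1: "K1 a b t \<turnstile> b \<rightarrow> a \<Longrightarrow> e \<turnstile> b \<Longrightarrow> K1 a b t \<longmapsto>[Arg e] t"
| lt_I: "I0 a \<turnstile> a \<rightarrow> a \<Longrightarrow> e \<turnstile> a \<Longrightarrow> I0 a \<longmapsto>[Arg e] e"
| lt_Inl: "TInl a b t \<turnstile> a \<boxplus> b \<Longrightarrow> TInl a b t \<longmapsto>[Sum1] t"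
| lt_Inr: "TInr a b t \<turnstile> a \<boxplus> b \<Longrightarrow> TInr a b t \<longmapsto>[Sum2] t"
| lt_Pair1: "TPair a b t s \<turnstile> a \<boxtimes> b \<Longrightarrow> TPair a b t s \<longmapsto>[Prod1] t"
| lt_Pair2: "TPair a b t s \<turnstile> a \<boxtimes> b \<Longrightarrow> TPair a b t s \<longmapsto>[Prod2] s"
| lt_Fold: "Fold \<tau> t \<turnstile> Mu \<tau> \<Longrightarrow> Fold \<tau> t \<longmapsto>[MuL] t"

inductive step :: "tm \<Rightarrow> tm \<Rightarrow> bool" (infix "\<longmapsto>" 50) where
  st_App: "App a b t s \<turnstile> b \<Longrightarrow> t \<longmapsto> t' \<Longrightarrow> App a b t s \<longmapsto> App a b t' s"
| st_AppL: "App a b t s \<turnstile> b \<Longrightarrow> t \<longmapsto>[Arg s] t' \<Longrightarrow> App a b t s \<longmapsto> t'"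
| st_Case: "Case a b c t s r \<turnstile> c \<Longrightarrow> t \<longmapsto> t' \<Longrightarrow> Case a b c t s r \<longmapsto> Case a b c t' s r"
| st_Case1: "Case a b c t s r \<turnstile> c \<Longrightarrow> t \<longmapsto>[Sum1] t' \<Longrightarrow> Case a b c t s r \<longmapsto> App a c s t'"
| st_Case2: "Case a b c t s r \<turnstile> c \<Longrightarrow> t \<longmapsto>[Sum2] t' \<Longrightarrow> Case a b c t s r \<longmapsto> App b c r t'"
| st_Fst: "Fst a b t \<turnstile> a \<Longrightarrow> t \<longmapsto> t' \<Longrightarrow> Fst a b t \<longmapsto> Fst a b t'"
| st_Snd: "Snd a b t \<turnstile> b \<Longrightarrow> t \<longmapsto> t' \<Longrightarrow> Snd a b t \<longmapsto> Snd a b t'"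
| st_FstL: "Fst a b t \<turnstile> a \<Longrightarrow> t \<longmapsto>[Prod1] t' \<Longrightarrow> Fst a b t \<longmapsto> t'"
| st_SndL: "Snd a b t \<turnstile> b \<Longrightarrow> t \<longmapsto>[Prod2] t' \<Longrightarrow> Snd a b t \<longmapsto> t'"
| st_Unfold: "Unfold \<tau> t \<turnstile> unroll \<tau> \<Longrightarrow> t \<longmapsto> t' \<Longrightarrow> Unfold \<tau> t \<longmapsto> Unfold \<tau> t'"
| st_UnfoldL: "Unfold \<tau> t \<turnstile> unroll \<tau> \<Longrightarrow> t \<longmapsto>[MuL] t' \<Longrightarrow> Unfold \<tau> t \<longmapsto> t'"

abbreviation wstep :: "tm \<Rightarrow> tm \<Rightarrow> bool" (infix "\<longmapsto>\<^sup>*" 50) where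
  "t \<longmapsto>\<^sup>* s \<equiv> step\<^sup>*\<^sup>* t s"

definition wltrans :: "tm \<Rightarrow> label \<Rightarrow> tm \<Rightarrow> bool" ("_ \<longmapsto>\<^sup>*[_] _" [51, 0, 51] 50) where
  "t \<longmapsto>\<^sup>*[l] s \<longleftrightarrow> (\<exists>t'. t \<longmapsto>\<^sup>* t' \<and> t' \<longmapsto>[l] s)"


section \<open>The step-indexed logical relation\<close>

type_synonym trel = "ty \<Rightarrow> (tm \<times> tm) set"

definition full_rel :: trel where
  "full_rel \<tau> = Tr \<tau> \<times> Tr \<tau>"

definition E_rel :: "trel \<Rightarrow> trel" where
  "E_rel R \<tau> = {(t, s) \<in> Tr \<tau> \<times> Tr \<tau>. \<forall>t'. t \<longmapsto> t' \<longrightarrow> (\<exists>s'. s \<longmapsto>\<^sup>* s' \<and> (t', s') \<in> R \<tau>)}"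

text \<open>The clause for type variables is irrelevant, as \<open>Tr (TVar i)\<close> is empty.\<close>

fun V_rel :: "trel \<Rightarrow> trel \<Rightarrow> trel" where
  "V_rel Q R (a \<boxplus> b) = {(t, s) \<in> Tr (a \<boxplus> b) \<times> Tr (a \<boxplus> b).
     (\<forall>t'. t \<longmapsto>[Sum1] t' \<longrightarrow> (\<exists>s'. s \<longmapsto>\<^sup>*[Sum1] s' \<and> (t', s') \<in> R a)) \<and>
     (\<forall>t'. t \<longmapsto>[Sum2] t' \<longrightarrow> (\<exists>s'. s \<longmapsto>\<^sup>*[Sum2] s' \<and> (t', s') \<in> R b))}"
| "V_rel Q R (a \<boxtimes> b) = {(t, s) \<in> Tr (a \<boxtimes> b) \<times> Tr (a \<boxtimes> b).
     \<forall>t\<^sub>1 t\<^sub>2. t \<longmapsto>[Prod1] t\<^sub>1 \<and> t \<longmapsto>[Prod2] t\<^sub>2 \<longrightarrow>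
       (\<exists>s\<^sub>1 s\<^sub>2. s \<longmapsto>\<^sup>*[Prod1] s\<^sub>1 \<and> s \<longmapsto>\<^sup>*[Prod2] s\<^sub>2 \<and> (t\<^sub>1, s\<^sub>1) \<in> R a \<and> (t\<^sub>2, s\<^sub>2) \<in> R b)}"
| "V_rel Q R (a \<rightarrow> b) = {(t, s) \<in> Tr (a \<rightarrow> b) \<times> Tr (a \<rightarrow> b).
     \<forall>e\<^sub>1 e\<^sub>2. (e\<^sub>1, e\<^sub>2) \<in> Q a \<longrightarrow>
       (\<forall>t'. t \<longmapsto>[Arg e\<^sub>1] t' \<longrightarrow> (\<exists>s'. s \<longmapsto>\<^sup>*[Arg e\<^sub>2] s' \<and> (t', s') \<in> R b))}"
| "V_rel Q R (Mu \<tau>) = {(t, s) \<in> Tr (Mu \<tau>) \<times> Tr (Mu \<tau>).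
     \<forall>t'. t \<longmapsto>[MuL] t' \<longrightarrow> (\<exists>s'. s \<longmapsto>\<^sup>*[MuL] s' \<and> (t', s') \<in> R (unroll \<tau>))}"
| "V_rel Q R (TVar i) = {}"

primrec L_fin :: "nat \<Rightarrow> trel" where
  "L_fin 0 = full_rel"
| "L_fin (Suc n) = (\<lambda>\<tau>. L_fin n \<tau> \<inter> E_rel (L_fin n) \<tau> \<inter> V_rel (L_fin n) (L_fin n) \<tau>)"

text \<open>The index set of ordinals up to omega is \<^typ>\<open>enat\<close>, with \<open>\<infinity>\<close> in the role of omega.\<close>

definition L_rel :: "enat \<Rightarrow> trel" where
  "L_rel \<alpha> = (case \<alpha> of enat n \<Rightarrow> L_fin n | \<infinity> \<Rightarrow> (\<lambda>\<tau>. \<Inter>n. L_fin n \<tau>))"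


section \<open>Congruences\<close>

text \<open>
  Compatibility with all operations of the signature; being an equivalence relation is not part of
  the notion.
\<close>

definition congruence :: "trel \<Rightarrow> bool" where
  "congruence R \<longleftrightarrow>
    (\<forall>f ts ss. wf_op f \<longrightarrow> list_all2 has_type ts (arg_tys f) \<longrightarrow> list_all2 has_type ss (arg_tys f) \<longrightarrow>
      (\<forall>i < length (arg_tys f). (ts ! i, ss ! i) \<in> R (arg_tys f ! i)) \<longrightarrow>
      (Op f ts, Op f ss) \<in> R (res_ty f))"

end

theory Submission
  imports Defs
begin

text \<open>
  By induction on the step index. In the successor step, an unlabelled step out of \<open>f(t\<^sub>1,\<dots>)\<close> either
  comes from a step of the first argument, matched by a weak step under the same evaluation context,
  or consumes a labelled transition of the first argument, which the clause for values matches
  because the remaining arguments are related at the previous index. A labelled transition of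
  \<open>f(t\<^sub>1,\<dots>)\<close> ends in a term built by the signature from the arguments and the input, so the
  compatibility of the previous index applies. The relation at \<open>\<omega>\<close> is an intersection of congruences.
\<close>

section \<open>Typing and weak transitions\<close>

text \<open>Operation symbols carry their type indices, so the root symbol determines the type, and
  typing unfolds into conditions on the immediate subterms.\<close>

lemma has_type_Op [simp]:
  "Op f ts \<turnstile> \<tau> \<longleftrightarrow> wf_op f \<and> list_all2 has_type ts (arg_tys f) \<and> \<tau> = res_ty f"
  by (subst has_type.simps) auto

lemma ltrans_has_type:
  assumes "t \<longmapsto>[l] t'"
  shows "t \<turnstile> a \<rightarrow> b \<Longrightarrow> l = Arg e \<Longrightarrow> t' \<turnstile> b"
    and "t \<turnstile> a \<boxplus> b \<Longrightarrow> l = Sum1 \<Longrightarrow> t' \<turnstile> a"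
    and "t \<turnstile> a \<boxplus> b \<Longrightarrow> l = Sum2 \<Longrightarrow> t' \<turnstile> b"
    and "t \<turnstile> a \<boxtimes> b \<Longrightarrow> l = Prod1 \<Longrightarrow> t' \<turnstile> a"
    and "t \<turnstile> a \<boxtimes> b \<Longrightarrow> l = Prod2 \<Longrightarrow> t' \<turnstile> b"
    and "t \<turnstile> Mu \<sigma> \<Longrightarrow> l = MuL \<Longrightarrow> t' \<turnstile> unroll \<sigma>"
  using assms by (auto elim: ltrans.cases)

lemma step_has_type: "t \<longmapsto> t' \<Longrightarrow> t \<turnstile> \<tau> \<Longrightarrow> t' \<turnstile> \<tau>"
  by (induction arbitrary: \<tau> rule: step.induct) (auto dest: ltrans_has_type)

lemma wstep_has_type: "t \<longmapsto>\<^sup>* t' \<Longrightarrow> t \<turnstile> \<tau> \<Longrightarrow> t' \<turnstile> \<tau>"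
  by (induction rule: rtranclp_induct) (auto intro: step_has_type)

text \<open>Step rules have typing premises, so closure under \<open>C\<close> can be demanded only
  for arguments of type \<open>\<sigma>\<close>. Subject reduction keeps every intermediate term at
  that type.\<close>

lemma wstep_context:
  assumes "t \<longmapsto>\<^sup>* t'" and "t \<turnstile> \<sigma>"
    and "\<And>u u'. u \<turnstile> \<sigma> \<Longrightarrow> u \<longmapsto> u' \<Longrightarrow> C u \<longmapsto> C u'"
  shows "C t \<longmapsto>\<^sup>* C t'"
  using assms(1)
proof (induction rule: rtranclp_induct)
  case (step u u')
  then show ?case
    using assms(3)[of u u'] wstep_has_type[OF step(1) assms(2)] by (meson rtranclp.rtrancl_into_rtrancl)
qed simp

text \<open>The silent prefix runs under \<open>C\<close>, and the final labelled transition is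
  consumed by one step of the enclosing term. This turns weak answers of a principal argument into
  weak steps of an elimination form.\<close>

lemma wltrans_context:
  assumes "t \<longmapsto>\<^sup>*[l] t'" and "t \<turnstile> \<sigma>"
    and "\<And>u u'. u \<turnstile> \<sigma> \<Longrightarrow> u \<longmapsto> u' \<Longrightarrow> C u \<longmapsto> C u'"
    and "\<And>u. u \<turnstile> \<sigma> \<Longrightarrow> u \<longmapsto>[l] t' \<Longrightarrow> C u \<longmapsto> r"
  shows "C t \<longmapsto>\<^sup>* r"
proof -
  from assms(1) obtain u where u: "t \<longmapsto>\<^sup>* u" "u \<longmapsto>[l] t'"
    by (auto simp: wltrans_def)
  have "C t \<longmapsto>\<^sup>* C u"
    using u(1) assms(2,3) by (rule wstep_context)
  moreover have "C u \<longmapsto> r"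
    using u(2) wstep_has_type[OF u(1) assms(2)] by (rule assms(4)[rotated])
  ultimately show ?thesis
    by (rule rtranclp.rtrancl_into_rtrancl)
qed

lemma ltrans_imp_wltrans: "t \<longmapsto>[l] t' \<Longrightarrow> t \<longmapsto>\<^sup>*[l] t'"
  by (auto simp: wltrans_def)

section \<open>Compatibility\<close>

text \<open>One list of related pairs replaces two argument lists with a condition on positions, so
  that \<open>list_all2\<close> can be unfolded along \<open>arg_tys f\<close>. Typing of both
  components follows from the bound by the full relation.\<close>

lemma congruence_iff:
  assumes "\<And>\<tau>. R \<tau> \<subseteq> full_rel \<tau>"
  shows "congruence R \<longleftrightarrow>
    (\<forall>f ps. wf_op f \<longrightarrow> list_all2 (\<lambda>p \<tau>. p \<in> R \<tau>) ps (arg_tys f) \<longrightarrow>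
      (Op f (map fst ps), Op f (map snd ps)) \<in> R (res_ty f))" (is "_ \<longleftrightarrow> ?C")
proof
  assume cong: "congruence R"
  show ?C
  proof (intro allI impI)
    fix f ps
    assume wf: "wf_op f" and ps: "list_all2 (\<lambda>p \<tau>. p \<in> R \<tau>) ps (arg_tys f)"
    have "fst p \<turnstile> \<tau> \<and> snd p \<turnstile> \<tau>" if "p \<in> R \<tau>" for p \<tau>
      using that assms[of \<tau>] by (auto simp: full_rel_def Tr_def)
    with ps have "list_all2 has_type (map fst ps) (arg_tys f)"
      "list_all2 has_type (map snd ps) (arg_tys f)"
      by (simp_all add: list_all2_conv_all_nth)
    with cong wf ps show "(Op f (map fst ps), Op f (map snd ps)) \<in> R (res_ty f)"
      unfolding congruence_def by (simp add: list_all2_conv_all_nth)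
  qed
next
  assume C: ?C
  show "congruence R"
    unfolding congruence_def
  proof (intro allI impI)
    fix f ts ss
    assume "wf_op f" "list_all2 has_type ts (arg_tys f)" "list_all2 has_type ss (arg_tys f)"
      "\<forall>i<length (arg_tys f). (ts ! i, ss ! i) \<in> R (arg_tys f ! i)"
    then show "(Op f ts, Op f ss) \<in> R (res_ty f)"
      using C[rule_format, of f "zip ts ss"] by (auto simp: list_all2_conv_all_nth)
  qed
qed

section \<open>Vacuous clauses and inversion of transitions\<close>

lemma E_rel_no_step:
  "t \<turnstile> \<tau> \<Longrightarrow> s \<turnstile> \<tau> \<Longrightarrow> (\<And>t'. \<not> t \<longmapsto> t') \<Longrightarrow> (t, s) \<in> E_rel R \<tau>"
  by (auto simp: E_rel_def Tr_def)

text \<open>Each clause of \<open>V_rel\<close> is an implication from a labelled transition, hence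
  vacuous here. Variables are excluded because there \<open>V_rel\<close> is empty.\<close>

lemma V_rel_no_ltrans:
  assumes "t \<turnstile> \<tau>" "s \<turnstile> \<tau>" "\<And>l t'. \<not> t \<longmapsto>[l] t'" "\<And>i. \<tau> \<noteq> TVar i"
  shows "(t, s) \<in> V_rel Q R \<tau>"
  using assms by (cases \<tau>) (auto simp: Tr_def)

text \<open>Substitution preserves every constructor other than a variable. The only variable
  allowed as a body is index 0, which is replaced by \<open>Mu (TVar 0)\<close>.\<close>

lemma unroll_neq_TVar: "closed_at 1 \<tau> \<Longrightarrow> unroll \<tau> \<noteq> TVar i"
  by (cases \<tau>) (auto simp: unroll_def)

lemma res_ty_neq_TVar: "wf_op f \<Longrightarrow> res_ty f \<noteq> TVar i"
  by (cases f) (auto simp: unroll_neq_TVar)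

inductive_cases App_stepE: "App a b t s \<longmapsto> u"
inductive_cases Case_stepE: "Case a b c t s r \<longmapsto> u"
inductive_cases Fst_stepE: "Fst a b t \<longmapsto> u"
inductive_cases Snd_stepE: "Snd a b t \<longmapsto> u"
inductive_cases Unfold_stepE: "Unfold \<tau> t \<longmapsto> u"

inductive_cases ltransE:
  "S0 a b c \<longmapsto>[l] u"
  "S1 a b c t \<longmapsto>[l] u"
  "S2 a b c t s \<longmapsto>[l] u"
  "K0 a b \<longmapsto>[l] u"
  "K1 a b t \<longmapsto>[l] u"
  "I0 a \<longmapsto>[l] u"
  "TInl a b t \<longmapsto>[l] u"
  "TInr a b t \<longmapsto>[l] u"
  "TPair a b t s \<longmapsto>[l] u"
  "Fold \<tau> t \<longmapsto>[l] u"

text \<open>This splits the signature by kind of transition: eliminators take only unlabelled steps,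
  all other operations only labelled transitions. So for every operation one of \<open>E_rel\<close>
  and \<open>V_rel\<close> imposes only typing.\<close>

primrec eliminator :: "opsym \<Rightarrow> bool" where
  "eliminator (AppOp a b) \<longleftrightarrow> True"
| "eliminator (CaseOp a b c) \<longleftrightarrow> True"
| "eliminator (FstOp a b) \<longleftrightarrow> True"
| "eliminator (SndOp a b) \<longleftrightarrow> True"
| "eliminator (UnfoldOp \<tau>) \<longleftrightarrow> True"
| "eliminator (S0Op a b c) \<longleftrightarrow> False"
| "eliminator (S1Op a b c) \<longleftrightarrow> False"
| "eliminator (S2Op a b c) \<longleftrightarrow> False"
| "eliminator (K0Op a b) \<longleftrightarrow> False"
| "eliminator (K1Op a b) \<longleftrightarrow> False"
| "eliminator (IOp a) \<longleftrightarrow> False"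
| "eliminator (InlOp a b) \<longleftrightarrow> False"
| "eliminator (InrOp a b) \<longleftrightarrow> False"
| "eliminator (PairOp a b) \<longleftrightarrow> False"
| "eliminator (FoldOp \<tau>) \<longleftrightarrow> False"

lemma step_eliminator: "Op f ts \<longmapsto> u \<Longrightarrow> eliminator f"
  by (cases rule: step.cases) auto

lemma ltrans_not_eliminator: "Op f ts \<longmapsto>[l] u \<Longrightarrow> \<not> eliminator f"
  by (cases rule: ltrans.cases) auto

text \<open>The passage from \<open>L_fin n\<close> to \<open>L_fin (Suc n)\<close>, abstracted to
  an arbitrary relation so that the successor case can be argued without indices.\<close>

definition lower :: "trel \<Rightarrow> trel" where
  "lower R \<tau> = R \<tau> \<inter> E_rel R \<tau> \<inter> V_rel R R \<tau>"

section \<open>Refining a congruence \<open>R\<close> once\<close>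

context
  fixes R :: trel
  assumes R_full: "\<And>\<tau>. R \<tau> \<subseteq> full_rel \<tau>"
    and R_cong: "congruence R"
begin

lemma R_has_type: "(t, s) \<in> R \<tau> \<Longrightarrow> t \<turnstile> \<tau> \<and> s \<turnstile> \<tau>"
  using R_full[of \<tau>] by (auto simp: full_rel_def Tr_def)

lemma R_Op:
  "wf_op f \<Longrightarrow> list_all2 (\<lambda>p \<tau>. p \<in> R \<tau>) ps (arg_tys f) \<Longrightarrow>
    (Op f (map fst ps), Op f (map snd ps)) \<in> R (res_ty f)"
  using R_cong congruence_iff[OF R_full] by blast

text \<open>The result type enters through an equation, so that the rule also applies to goals whose
  type is not literally of the form \<open>res_ty f\<close>. The rules for two and three arguments
  follow the same pattern.\<close>

lemma R_Op1:
  "wf_op f \<Longrightarrow> arg_tys f = [a] \<Longrightarrow> (t, t') \<in> R a \<Longrightarrow> res_ty f = \<tau> \<Longrightarrow>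
    (Op f [t], Op f [t']) \<in> R \<tau>"
  using R_Op[of f "[(t, t')]"] by simp

lemma R_Op2:
  "wf_op f \<Longrightarrow> arg_tys f = [a, b] \<Longrightarrow> (t, t') \<in> R a \<Longrightarrow> (s, s') \<in> R b \<Longrightarrow> res_ty f = \<tau> \<Longrightarrow>
    (Op f [t, s], Op f [t', s']) \<in> R \<tau>"
  using R_Op[of f "[(t, t'), (s, s')]"] by simp

lemma R_Op3:
  "wf_op f \<Longrightarrow> arg_tys f = [a, b, c] \<Longrightarrow> (t, t') \<in> R a \<Longrightarrow> (s, s') \<in> R b \<Longrightarrow> (r, r') \<in> R c \<Longrightarrow>
    res_ty f = \<tau> \<Longrightarrow> (Op f [t, s, r], Op f [t', s', r']) \<in> R \<tau>"
  using R_Op[of f "[(t, t'), (s, s'), (r, r')]"] by simp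

lemma lower_R: "(t, s) \<in> lower R \<tau> \<Longrightarrow> (t, s) \<in> R \<tau>"
  by (simp add: lower_def)

lemma lower_has_type: "(t, s) \<in> lower R \<tau> \<Longrightarrow> t \<turnstile> \<tau> \<and> s \<turnstile> \<tau>"
  using R_has_type lower_R by blast

lemma lower_step:
  "(t, s) \<in> lower R \<tau> \<Longrightarrow> t \<longmapsto> t' \<Longrightarrow> \<exists>s'. s \<longmapsto>\<^sup>* s' \<and> (t', s') \<in> R \<tau>"
  by (auto simp: lower_def E_rel_def)

lemma lower_ltrans:
  shows "(t, s) \<in> lower R (a \<rightarrow> b) \<Longrightarrow> t \<longmapsto>[Arg e] t' \<Longrightarrow> (e, d) \<in> R a \<Longrightarrow>
      \<exists>s'. s \<longmapsto>\<^sup>*[Arg d] s' \<and> (t', s') \<in> R b"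
    and "(t, s) \<in> lower R (a \<boxplus> b) \<Longrightarrow> t \<longmapsto>[Sum1] t' \<Longrightarrow> \<exists>s'. s \<longmapsto>\<^sup>*[Sum1] s' \<and> (t', s') \<in> R a"
    and "(t, s) \<in> lower R (a \<boxplus> b) \<Longrightarrow> t \<longmapsto>[Sum2] t' \<Longrightarrow> \<exists>s'. s \<longmapsto>\<^sup>*[Sum2] s' \<and> (t', s') \<in> R b"
    and "(t, s) \<in> lower R (Mu \<sigma>) \<Longrightarrow> t \<longmapsto>[MuL] t' \<Longrightarrow>
      \<exists>s'. s \<longmapsto>\<^sup>*[MuL] s' \<and> (t', s') \<in> R (unroll \<sigma>)"
  by (auto simp: lower_def)

text \<open>
  The value clause for products assumes both projections at once; it applies because a term with one
  projection also has the other.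
\<close>

lemma lower_Prod:
  assumes "(t, s) \<in> lower R (a \<boxtimes> b)"
  shows "t \<longmapsto>[Prod1] t' \<Longrightarrow> \<exists>s'. s \<longmapsto>\<^sup>*[Prod1] s' \<and> (t', s') \<in> R a"
    and "t \<longmapsto>[Prod2] t' \<Longrightarrow> \<exists>s'. s \<longmapsto>\<^sup>*[Prod2] s' \<and> (t', s') \<in> R b"
proof -
  have *: "\<exists>s\<^sub>1 s\<^sub>2. s \<longmapsto>\<^sup>*[Prod1] s\<^sub>1 \<and> s \<longmapsto>\<^sup>*[Prod2] s\<^sub>2 \<and> (t\<^sub>1, s\<^sub>1) \<in> R a \<and> (t\<^sub>2, s\<^sub>2) \<in> R b"
    if "t \<longmapsto>[Prod1] t\<^sub>1" "t \<longmapsto>[Prod2] t\<^sub>2" for t\<^sub>1 t\<^sub>2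
    using assms that by (simp add: lower_def)
  show "\<exists>s'. s \<longmapsto>\<^sup>*[Prod1] s' \<and> (t', s') \<in> R a" if "t \<longmapsto>[Prod1] t'"
    using that
  proof cases
    case (lt_Pair1 a b u)
    then show ?thesis
      using *[OF that] lt_Pair2 by blast
  qed
  show "\<exists>s'. s \<longmapsto>\<^sup>*[Prod2] s' \<and> (t', s') \<in> R b" if "t \<longmapsto>[Prod2] t'"
    using that
  proof cases
    case (lt_Pair2 a b u)
    then show ?thesis
      using *[OF _ that] lt_Pair1 by blast
  qed
qed

section \<open>Compatibility with eliminators\<close>

lemma lower_App:
  assumes wf: "wf_op (AppOp a b)"
    and t: "(t, t') \<in> lower R (a \<rightarrow> b)" and s: "(s, s') \<in> lower R a"
  shows "(App a b t s, App a b t' s') \<in> lower R b"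
proof -
  note ty = lower_has_type[OF t] lower_has_type[OF s]
  have inner: "App a b u s' \<longmapsto> App a b u' s'" if "u \<turnstile> a \<rightarrow> b" "u \<longmapsto> u'" for u u'
    using that wf ty by (auto intro: st_App)
  have "\<exists>v. App a b t' s' \<longmapsto>\<^sup>* v \<and> (u, v) \<in> R b" if "App a b t s \<longmapsto> u" for u
    using that
  proof (rule App_stepE)
    fix u' assume u: "u = App a b u' s" and "t \<longmapsto> u'"
    then obtain v' where v': "t' \<longmapsto>\<^sup>* v'" "(u', v') \<in> R (a \<rightarrow> b)"
      using lower_step[OF t] by blast
    have "App a b t' s' \<longmapsto>\<^sup>* App a b v' s'"
      using v'(1) ty inner by (intro wstep_context[where C = "\<lambda>x. App a b x s'"]) auto
    \<comment> \<open>The new heads are related only by \<open>R\<close>, which is enough: the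
      target of a matched step has to lie in \<open>R\<close>, and \<open>R\<close> is a
      congruence.\<close>
    moreover have "(u, App a b v' s') \<in> R b"
      unfolding u using wf v'(2) lower_R[OF s] by (intro R_Op2) auto
    ultimately show ?thesis by blast
  next
    assume "t \<longmapsto>[Arg s] u"
    \<comment> \<open>\<open>lower\<close> puts \<open>R\<close> in both places of
      \<open>V_rel\<close>, so the inputs \<open>s\<close> and \<open>s'\<close>, being related by
      \<open>R\<close>, are admissible. The answer then carries exactly the label that an
      application to \<open>s'\<close> consumes.\<close>
    then obtain v where v: "t' \<longmapsto>\<^sup>*[Arg s'] v" "(u, v) \<in> R b"
      using lower_ltrans(1)[OF t _ lower_R[OF s]] by blast
    have "App a b t' s' \<longmapsto>\<^sup>* v"
      by (rule wltrans_context[where C = "\<lambda>x. App a b x s'", OF v(1)])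
        (use ty wf inner in \<open>auto intro: st_AppL\<close>)
    with v(2) show ?thesis by blast
  qed
  \<comment> \<open>An application has no labelled transitions, and \<open>b\<close> is closed,
    hence not a variable.\<close>
  moreover have "(App a b t s, App a b t' s') \<in> V_rel R R b"
    by (rule V_rel_no_ltrans) (use wf ty in \<open>auto dest: ltrans_not_eliminator\<close>)
  moreover have "(App a b t s, App a b t' s') \<in> R b"
    using wf lower_R[OF t] lower_R[OF s] by (intro R_Op2) auto
  ultimately show ?thesis
    using wf ty by (auto simp: lower_def E_rel_def Tr_def)
qed

lemma lower_Case:
  assumes wf: "wf_op (CaseOp a b c)"
    and t: "(t, t') \<in> lower R (a \<boxplus> b)" and s: "(s, s') \<in> lower R (a \<rightarrow> c)"
    and r: "(r, r') \<in> lower R (b \<rightarrow> c)"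
  shows "(Case a b c t s r, Case a b c t' s' r') \<in> lower R c"
proof -
  note ty = lower_has_type[OF t] lower_has_type[OF s] lower_has_type[OF r]
  have inner: "Case a b c u s' r' \<longmapsto> Case a b c u' s' r'" if "u \<turnstile> a \<boxplus> b" "u \<longmapsto> u'" for u u'
    using that wf ty by (auto intro: st_Case)
  have "\<exists>v. Case a b c t' s' r' \<longmapsto>\<^sup>* v \<and> (u, v) \<in> R c" if "Case a b c t s r \<longmapsto> u" for u
    using that
  proof (rule Case_stepE)
    fix u' assume u: "u = Case a b c u' s r" and "t \<longmapsto> u'"
    then obtain v' where v': "t' \<longmapsto>\<^sup>* v'" "(u', v') \<in> R (a \<boxplus> b)"
      using lower_step[OF t] by blast
    have "Case a b c t' s' r' \<longmapsto>\<^sup>* Case a b c v' s' r'"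
      using v'(1) ty inner by (intro wstep_context[where C = "\<lambda>x. Case a b c x s' r'"]) auto
    moreover have "(u, Case a b c v' s' r') \<in> R c"
      unfolding u using wf v'(2) lower_R[OF s] lower_R[OF r] by (intro R_Op3) auto
    ultimately show ?thesis by blast
  next
    fix u' assume u: "u = App a c s u'" and "t \<longmapsto>[Sum1] u'"
    then obtain v where v: "t' \<longmapsto>\<^sup>*[Sum1] v" "(u', v) \<in> R a"
      using lower_ltrans(2)[OF t] by blast
    have "Case a b c t' s' r' \<longmapsto>\<^sup>* App a c s' v"
      by (rule wltrans_context[where C = "\<lambda>x. Case a b c x s' r'", OF v(1)])
        (use ty wf inner in \<open>auto intro: st_Case1\<close>)
    \<comment> \<open>The branch is applied but not yet evaluated, so compatibility of
      \<open>R\<close> with \<open>AppOp\<close> relates the two results.\<close>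
    moreover have "(u, App a c s' v) \<in> R c"
      unfolding u using wf v(2) lower_R[OF s] by (intro R_Op2) auto
    ultimately show ?thesis by blast
  next
    fix u' assume u: "u = App b c r u'" and "t \<longmapsto>[Sum2] u'"
    then obtain v where v: "t' \<longmapsto>\<^sup>*[Sum2] v" "(u', v) \<in> R b"
      using lower_ltrans(3)[OF t] by blast
    have "Case a b c t' s' r' \<longmapsto>\<^sup>* App b c r' v"
      by (rule wltrans_context[where C = "\<lambda>x. Case a b c x s' r'", OF v(1)])
        (use ty wf inner in \<open>auto intro: st_Case2\<close>)
    moreover have "(u, App b c r' v) \<in> R c"
      unfolding u using wf v(2) lower_R[OF r] by (intro R_Op2) auto
    ultimately show ?thesis by blast
  qed
  moreover have "(Case a b c t s r, Case a b c t' s' r') \<in> V_rel R R c"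
    by (rule V_rel_no_ltrans) (use wf ty in \<open>auto dest: ltrans_not_eliminator\<close>)
  moreover have "(Case a b c t s r, Case a b c t' s' r') \<in> R c"
    using wf lower_R[OF t] lower_R[OF s] lower_R[OF r] by (intro R_Op3) auto
  ultimately show ?thesis
    using wf ty by (auto simp: lower_def E_rel_def Tr_def)
qed

text \<open>
  Instantiated to \<open>Fst\<close>, \<open>Snd\<close> and \<open>Unfold\<close>, which differ only in the label \<open>l\<close> they consume.
\<close>

lemma lower_eliminator:
  assumes wf: "wf_op f" and f: "eliminator f" and arg: "arg_tys f = [\<sigma>]"
    and t: "(t, t') \<in> lower R \<sigma>"
    and step_cases: "\<And>u. Op f [t] \<longmapsto> u \<Longrightarrow> (\<exists>u'. u = Op f [u'] \<and> t \<longmapsto> u') \<or> t \<longmapsto>[l] u"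
    and inner: "\<And>u u'. u \<turnstile> \<sigma> \<Longrightarrow> u \<longmapsto> u' \<Longrightarrow> Op f [u] \<longmapsto> Op f [u']"
    and elim: "\<And>u u'. u \<turnstile> \<sigma> \<Longrightarrow> u \<longmapsto>[l] u' \<Longrightarrow> Op f [u] \<longmapsto> u'"
    and matched: "\<And>u. t \<longmapsto>[l] u \<Longrightarrow> \<exists>v. t' \<longmapsto>\<^sup>*[l] v \<and> (u, v) \<in> R (res_ty f)"
  shows "(Op f [t], Op f [t']) \<in> lower R (res_ty f)"
proof -
  note ty = lower_has_type[OF t]
  have "\<exists>v. Op f [t'] \<longmapsto>\<^sup>* v \<and> (u, v) \<in> R (res_ty f)" if "Op f [t] \<longmapsto> u" for u
    using step_cases[OF that]
  proof (elim disjE exE conjE)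
    fix u' assume u: "u = Op f [u']" and "t \<longmapsto> u'"
    then obtain v' where v': "t' \<longmapsto>\<^sup>* v'" "(u', v') \<in> R \<sigma>"
      using lower_step[OF t] by blast
    have "Op f [t'] \<longmapsto>\<^sup>* Op f [v']"
      using v'(1) ty inner by (intro wstep_context[where C = "\<lambda>x. Op f [x]"]) auto
    moreover have "(u, Op f [v']) \<in> R (res_ty f)"
      unfolding u using wf arg v'(2) by (intro R_Op1) auto
    ultimately show ?thesis by blast
  next
    assume "t \<longmapsto>[l] u"
    then obtain v where v: "t' \<longmapsto>\<^sup>*[l] v" "(u, v) \<in> R (res_ty f)"
      using matched by blast
    have "Op f [t'] \<longmapsto>\<^sup>* v"
      by (rule wltrans_context[where C = "\<lambda>x. Op f [x]", OF v(1)]) (use ty inner elim in auto)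
    with v(2) show ?thesis by blast
  qed
  \<comment> \<open>The result type may be an unrolling, so excluding variables rests on
    \<open>res_ty_neq_TVar\<close>.\<close>
  moreover have "(Op f [t], Op f [t']) \<in> V_rel R R (res_ty f)"
    by (rule V_rel_no_ltrans) (use wf f arg ty in \<open>auto dest: ltrans_not_eliminator res_ty_neq_TVar\<close>)
  moreover have "(Op f [t], Op f [t']) \<in> R (res_ty f)"
    using wf arg lower_R[OF t] by (intro R_Op1) auto
  ultimately show ?thesis
    using wf arg ty by (auto simp: lower_def E_rel_def Tr_def)
qed

lemma lower_Fst:
  assumes wf: "wf_op (FstOp a b)" and t: "(t, t') \<in> lower R (a \<boxtimes> b)"
  shows "(Fst a b t, Fst a b t') \<in> lower R a"
proof -
  have "(Fst a b t, Fst a b t') \<in> lower R (res_ty (FstOp a b))"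
    by (rule lower_eliminator[where l = Prod1, OF wf _ _ t])
      (use wf lower_Prod(1)[OF t] in \<open>auto elim: Fst_stepE intro: st_Fst st_FstL\<close>)
  then show ?thesis by simp
qed

lemma lower_Snd:
  assumes wf: "wf_op (SndOp a b)" and t: "(t, t') \<in> lower R (a \<boxtimes> b)"
  shows "(Snd a b t, Snd a b t') \<in> lower R b"
proof -
  have "(Snd a b t, Snd a b t') \<in> lower R (res_ty (SndOp a b))"
    by (rule lower_eliminator[where l = Prod2, OF wf _ _ t])
      (use wf lower_Prod(2)[OF t] in \<open>auto elim: Snd_stepE intro: st_Snd st_SndL\<close>)
  then show ?thesis by simp
qed

lemma lower_Unfold:
  assumes wf: "wf_op (UnfoldOp \<tau>)" and t: "(t, t') \<in> lower R (Mu \<tau>)"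
  shows "(Unfold \<tau> t, Unfold \<tau> t') \<in> lower R (unroll \<tau>)"
proof -
  have "(Unfold \<tau> t, Unfold \<tau> t') \<in> lower R (res_ty (UnfoldOp \<tau>))"
    by (rule lower_eliminator[where l = MuL, OF wf _ _ t])
      (use wf lower_ltrans(4)[OF t] in \<open>auto elim: Unfold_stepE intro: st_Unfold st_UnfoldL\<close>)
  then show ?thesis by simp
qed

section \<open>Operations with labelled transitions, and the whole signature\<close>

lemma lower_value:
  assumes wf: "wf_op f"
    and ps: "list_all2 (\<lambda>p \<tau>. p \<in> lower R \<tau>) ps (arg_tys f)"
    and f: "\<not> eliminator f"
    and V: "(Op f (map fst ps), Op f (map snd ps)) \<in> V_rel R R (res_ty f)"
  shows "(Op f (map fst ps), Op f (map snd ps)) \<in> lower R (res_ty f)"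
proof -
  have "list_all2 (\<lambda>p \<tau>. p \<in> R \<tau>) ps (arg_tys f)"
    using ps by (rule list_all2_mono) (auto simp: lower_def)
  then have R: "(Op f (map fst ps), Op f (map snd ps)) \<in> R (res_ty f)"
    by (rule R_Op[OF wf])
  \<comment> \<open>Without unlabelled steps the clause for steps is vacuous, so \<open>V\<close> is
    the only condition left to check for each operation.\<close>
  moreover from R have "(Op f (map fst ps), Op f (map snd ps)) \<in> E_rel R (res_ty f)"
    using f R_has_type by (blast intro: E_rel_no_step dest: step_eliminator)
  ultimately show ?thesis
    using V by (simp add: lower_def)
qed

text \<open>Both sides have the same combinator at the root, so the right side can answer with a
  single labelled transition and no silent steps before it.\<close>

lemma V_rel_ArrI:
  assumes "t \<turnstile> a \<rightarrow> b" "s \<turnstile> a \<rightarrow> b"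
    and "\<And>d e t'. (e, d) \<in> R a \<Longrightarrow> t \<longmapsto>[Arg e] t' \<Longrightarrow> \<exists>s'. s \<longmapsto>[Arg d] s' \<and> (t', s') \<in> R b"
  shows "(t, s) \<in> V_rel R R (a \<rightarrow> b)"
  using assms by (auto simp: Tr_def) (meson ltrans_imp_wltrans)

lemma lower_Op:
  assumes wf: "wf_op f" and ps: "list_all2 (\<lambda>p \<tau>. p \<in> lower R \<tau>) ps (arg_tys f)"
  shows "(Op f (map fst ps), Op f (map snd ps)) \<in> lower R (res_ty f)"
proof -
  have val: "(Op f (map fst ps), Op f (map snd ps)) \<in> lower R (res_ty f)"
    if "\<not> eliminator f"
      "(Op f (map fst ps), Op f (map snd ps)) \<in> V_rel R R (res_ty f)"
    using lower_value[OF wf ps] that by blast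
  show ?thesis
  proof (cases f)
    case (S0Op a b c)
    have "(S0 a b c, S0 a b c) \<in> V_rel R R ((a \<rightarrow> b \<rightarrow> c) \<rightarrow> (a \<rightarrow> b) \<rightarrow> a \<rightarrow> c)"
      using wf S0Op
      by (intro V_rel_ArrI)
        (auto elim!: ltransE intro!: exI lt_S0 R_Op1 dest: R_has_type)
    then show ?thesis
      using val ps S0Op by simp
  next
    case (S1Op a b c)
    with ps obtain t t' where p: "ps = [(t, t')]" and t: "(t, t') \<in> lower R (a \<rightarrow> b \<rightarrow> c)"
      by (auto simp: list_all2_Cons2)
    have "(S1 a b c t, S1 a b c t') \<in> V_rel R R ((a \<rightarrow> b) \<rightarrow> a \<rightarrow> c)"
      using wf S1Op lower_has_type[OF t] lower_R[OF t]
      by (intro V_rel_ArrI)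
        (auto elim!: ltransE intro!: exI lt_S1 R_Op2 dest: R_has_type)
    then show ?thesis
      using val p S1Op by simp
  next
    case (S2Op a b c)
    with ps obtain t t' s s' where p: "ps = [(t, t'), (s, s')]"
      and t: "(t, t') \<in> lower R (a \<rightarrow> b \<rightarrow> c)" and s: "(s, s') \<in> lower R (a \<rightarrow> b)"
      by (auto simp: list_all2_Cons2)
    \<comment> \<open>The targets are three nested applications that duplicate the input;
      \<open>R_Op2\<close> is used once for each application.\<close>
    have "(S2 a b c t s, S2 a b c t' s') \<in> V_rel R R (a \<rightarrow> c)"
      using wf S2Op lower_has_type[OF t] lower_R[OF t] lower_has_type[OF s] lower_R[OF s]
      by (intro V_rel_ArrI)
        (auto elim!: ltransE intro!: exI lt_S2 R_Op2 dest: R_has_type)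
    then show ?thesis
      using val p S2Op by simp
  next
    case (K0Op a b)
    have "(K0 a b, K0 a b) \<in> V_rel R R (a \<rightarrow> b \<rightarrow> a)"
      using wf K0Op
      by (intro V_rel_ArrI)
        (auto elim!: ltransE intro!: exI lt_K0 R_Op1 dest: R_has_type)
    then show ?thesis
      using val ps K0Op by simp
  next
    case (K1Op a b)
    with ps obtain t t' where p: "ps = [(t, t')]" and t: "(t, t') \<in> lower R a"
      by (auto simp: list_all2_Cons2)
    \<comment> \<open>The targets are the stored arguments, already related by \<open>R\<close>; the
      input is discarded.\<close>
    have "(K1 a b t, K1 a b t') \<in> V_rel R R (b \<rightarrow> a)"
      using wf K1Op lower_has_type[OF t] lower_R[OF t]
      by (intro V_rel_ArrI)
        (auto elim!: ltransE intro!: exI lt_K1 dest: R_has_type)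
    then show ?thesis
      using val p K1Op by simp
  next
    case (IOp a)
    have "(I0 a, I0 a) \<in> V_rel R R (a \<rightarrow> a)"
      using wf IOp
      by (intro V_rel_ArrI)
        (auto elim!: ltransE intro!: exI lt_I dest: R_has_type)
    then show ?thesis
      using val ps IOp by simp
  next
    case (InlOp a b)
    with ps obtain t t' where p: "ps = [(t, t')]" and t: "(t, t') \<in> lower R a"
      by (auto simp: list_all2_Cons2)
    have "(TInl a b t, TInl a b t') \<in> V_rel R R (a \<boxplus> b)"
      using wf InlOp lower_has_type[OF t] lower_R[OF t]
      by (auto simp: Tr_def elim!: ltransE intro!: exI ltrans_imp_wltrans lt_Inl)
    then show ?thesis
      using val p InlOp by simp
  next
    case (InrOp a b)
    with ps obtain t t' where p: "ps = [(t, t')]" and t: "(t, t') \<in> lower R b"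
      by (auto simp: list_all2_Cons2)
    have "(TInr a b t, TInr a b t') \<in> V_rel R R (a \<boxplus> b)"
      using wf InrOp lower_has_type[OF t] lower_R[OF t]
      by (auto simp: Tr_def elim!: ltransE intro!: exI ltrans_imp_wltrans lt_Inr)
    then show ?thesis
      using val p InrOp by simp
  next
    case (PairOp a b)
    with ps obtain t t' s s' where p: "ps = [(t, t'), (s, s')]"
      and t: "(t, t') \<in> lower R a" and s: "(s, s') \<in> lower R b"
      by (auto simp: list_all2_Cons2)
    have "(TPair a b t s, TPair a b t' s') \<in> V_rel R R (a \<boxtimes> b)"
      using wf PairOp lower_has_type[OF t] lower_R[OF t] lower_has_type[OF s] lower_R[OF s]
      by (auto simp: Tr_def elim!: ltransE intro!: exI ltrans_imp_wltrans lt_Pair1 lt_Pair2)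
    then show ?thesis
      using val p PairOp by simp
  next
    case (FoldOp \<sigma>)
    with ps obtain t t' where p: "ps = [(t, t')]" and t: "(t, t') \<in> lower R (unroll \<sigma>)"
      by (auto simp: list_all2_Cons2)
    have "(Fold \<sigma> t, Fold \<sigma> t') \<in> V_rel R R (Mu \<sigma>)"
      using wf FoldOp lower_has_type[OF t] lower_R[OF t]
      by (auto simp: Tr_def elim!: ltransE intro!: exI ltrans_imp_wltrans lt_Fold)
    then show ?thesis
      using val p FoldOp by simp
  next
    case (AppOp a b)
    then show ?thesis
      using wf ps lower_App by (auto simp: list_all2_Cons2)
  next
    case (CaseOp a b c)
    then show ?thesis
      using wf ps lower_Case by (auto simp: list_all2_Cons2)
  next
    case (FstOp a b)
    then show ?thesis
      using wf ps lower_Fst by (auto simp: list_all2_Cons2)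
  next
    case (SndOp a b)
    then show ?thesis
      using wf ps lower_Snd by (auto simp: list_all2_Cons2)
  next
    case (UnfoldOp \<sigma>)
    then show ?thesis
      using wf ps lower_Unfold by (auto simp: list_all2_Cons2)
  qed
qed

end

section \<open>Induction on the step index\<close>

lemma L_fin_Suc: "L_fin (Suc n) = lower (L_fin n)"
  by (simp add: lower_def fun_eq_iff)

lemma L_fin_full: "L_fin n \<tau> \<subseteq> full_rel \<tau>"
  by (induction n) auto

lemma lower_full: "(\<And>\<tau>. R \<tau> \<subseteq> full_rel \<tau>) \<Longrightarrow> lower R \<tau> \<subseteq> full_rel \<tau>"
  by (auto simp: lower_def)

lemma congruence_lower:
  assumes "\<And>\<tau>. R \<tau> \<subseteq> full_rel \<tau>" "congruence R"
  shows "congruence (lower R)"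
  using lower_Op[OF assms] congruence_iff[OF lower_full[OF assms(1)]] by blast

lemma congruence_L_fin: "congruence (L_fin n)"
proof (induction n)
  case 0
  show ?case
    \<comment> \<open>The full relation asks only for typing, which the hypotheses inside
      \<open>congruence\<close> supply.\<close>
    by (auto simp: congruence_def full_rel_def Tr_def)
next
  case (Suc n)
  then show ?case
    unfolding L_fin_Suc by (intro congruence_lower L_fin_full)
qed

theorem theorem3p4:
  fixes \<alpha> :: enat
  shows "congruence (L_rel \<alpha>)"
proof (cases \<alpha>)
  case (enat n)
  then show ?thesis
    by (simp add: L_rel_def congruence_L_fin)
next
  case infinity
  then show ?thesis
    \<comment> \<open>Arguments related in the intersection are related at each \<open>n\<close>, so
      compatibility is applied separately at every finite index.\<close>
    using congruence_L_fin by (simp add: L_rel_def congruence_def)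
qed

end
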